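(* Let $\sum(l_1,\dots,l_m;q)$ be a multigeometric series with sum $s$, let $E$ be its set of subsums and let $F_m$ be the set of its $m$-initial subsums. Put $\delta(F_m):=\min\{|f-g|:\ f,g\in F_m,\ f\neq g\}$. Suppose that $$2qs<\delta(F_m)\qquad\text{and}\qquad qs<1.$$ Then $$C(E)=\bigcup_{k=0}^\infty q^kC(F_m).$$
   Context: Throughout, a series $\sum a_n$ is a convergent series $\sum_{n=1}^\infty a_n$ with positive and nonincreasing terms; $\mathbb N=\{1,2,\dots\}$ and $\mathbb N_0=\mathbb N\cup\{0\}$. A series $\sum a_n$ is multigeometric if there are positive integers $m$ and $l_1\ge l_2\ge\dots\ge l_m$ and a number $q\in(0,1)$ such that $a_{km+i}=l_iq^k$ for all $k\in\mathbb N_0$ and $i\in\{1,\dots,m\}$; it is denoted $\sum(l_1,\dots,l_m;q)$, and its sum is $s=\frac{1}{1-q}\sum_{i=1}^m l_i$. The set of subsums is $E:=\{\sum_{n\in A}a_n:\ A\subset\mathbb N\}$ and the set of $k$-initial subsums is $F_k:=\{\sum_{n\in A}a_n:\ A\subset\{1,\dots,k\}\}$ (the empty sum is $0$). For a nonempty subset $A$ of a metric space $(X,d)$, the center of distances of $A$ is $C(A):=\{\alpha\in[0,+\infty):\ \forall x\in A\ \exists y\in A\ d(x,y)=\alpha\}$; subsets of $\mathbb R$ carry the usual metric. For $c\in\mathbb R$ and $P\subset\mathbb R$, $cP:=\{cp:\ p\in P\}$. *)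

theory Defs
  imports "HOL-Analysis.Analysis"
begin

text \<open>A series is given by its sequence of terms \<open>a 1, a 2, \<dots>\<close>; the value \<open>a 0\<close> is never used.\<close>

definition pos_noninc_series :: "(nat \<Rightarrow> real) \<Rightarrow> bool" where
  "pos_noninc_series a \<longleftrightarrow>
     (\<forall>n\<ge>1. a n > 0) \<and> (\<forall>n\<ge>1. a (Suc n) \<le> a n) \<and> summable (\<lambda>n. a (Suc n))"

definition series_sum :: "(nat \<Rightarrow> real) \<Rightarrow> real" where
  "series_sum a = (\<Sum>n. a (Suc n))"

text \<open>Only the values \<open>l 1, \<dots>, l m\<close> matter. Membership in the class of series with positive
  nonincreasing terms is part of the notion; it also forces \<open>q * l 1 \<le> l m\<close>.\<close>

definition multigeometric :: "(nat \<Rightarrow> real) \<Rightarrow> nat \<Rightarrow> (nat \<Rightarrow> nat) \<Rightarrow> real \<Rightarrow> bool" where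
  "multigeometric a m l q \<longleftrightarrow>
     pos_noninc_series a \<and>
     m \<ge> 1 \<and> (\<forall>i\<in>{1..m}. l i > 0) \<and>
     (\<forall>i\<in>{1..m}. \<forall>j\<in>{1..m}. i \<le> j \<longrightarrow> l j \<le> l i) \<and>
     0 < q \<and> q < 1 \<and>
     (\<forall>k. \<forall>i\<in>{1..m}. a (k * m + i) = real (l i) * q ^ k)"

definition subsums :: "(nat \<Rightarrow> real) \<Rightarrow> real set" where
  "subsums a = {infsum a A | A. A \<subseteq> {1..}}"

definition initial_subsums :: "(nat \<Rightarrow> real) \<Rightarrow> nat \<Rightarrow> real set" where
  "initial_subsums a k = {sum a A | A. A \<subseteq> {1..k}}"

definition center_of_distances :: "'a::metric_space set \<Rightarrow> real set" where
  "center_of_distances A = {\<alpha>. \<alpha> \<ge> 0 \<and> (\<forall>x\<in>A. \<exists>y\<in>A. dist x y = \<alpha>)}"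

text \<open>Meaningful for finite sets with at least two elements, where the minimum exists.\<close>

definition min_gap :: "real set \<Rightarrow> real" where
  "min_gap P = Min {\<bar>f - g\<bar> | f g. f \<in> P \<and> g \<in> P \<and> f \<noteq> g}"

end

theory Submission
  imports Defs
begin

text \<open>
  Write \<open>F\<close> for the set of \<open>m\<close>-initial subsums. Since \<open>a (n + m) = q * a n\<close>, the set of subsums
  is self-similar, \<open>E = F + qE\<close>, and it lies in \<open>[0, s]\<close> and contains both end points. The theorem
  is a statement about such sets (\<open>center_of_distances_self_similar\<close>).

  Moving only the first digit \<open>f\<close> of \<open>x = f + qe\<close> shows \<open>C(F) \<subseteq> C(E)\<close>, and moving only the tail \<open>e\<close>
  shows \<open>qC(E) \<subseteq> C(E)\<close>; this gives one inclusion. For the other, let \<open>\<alpha> \<in> C(E)\<close>.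

  If \<open>\<alpha> \<le> qs\<close>, two points of \<open>E\<close> at distance \<open>\<alpha>\<close> have first digits at distance at most
  \<open>2qs < \<delta>(F)\<close>, so they share the first digit, and \<open>\<alpha>/q \<in> C(E)\<close>. Repeating this, a positive \<open>\<alpha>\<close>
  grows until it exceeds \<open>qs\<close>.

  If \<open>\<alpha> > qs\<close>, test \<open>\<alpha>\<close> at the two ends of the leftmost piece \<open>qE\<close>. From \<open>0\<close> and from \<open>qs\<close> it is
  only possible to move to the right, so \<open>\<alpha> = f + qe\<close> and \<open>qs + \<alpha> = g + qe'\<close> both lie in \<open>E\<close>. The
  gap condition forces \<open>f = g\<close>, hence \<open>e + s = e' \<le> s\<close>, so \<open>e = 0\<close> and \<open>\<alpha> \<in> F\<close> is an integer. Now
  moving a point of \<open>F\<close> by \<open>\<alpha>\<close> inside \<open>E\<close> leads to an integer in \<open>E\<close>, and since \<open>qE \<subseteq> [0, 1)\<close> the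
  only integers in \<open>E\<close> are the elements of \<open>F\<close>; thus \<open>\<alpha> \<in> C(F)\<close>.
\<close>

lemma zero_in_center_of_distances: "0 \<in> center_of_distances A"
  by (auto simp: center_of_distances_def)

text \<open>The minimum defining the gap is taken over a finite set, since the differences form a
  subset of an image of \<open>P \<times> P\<close>.\<close>

lemma min_gap_le:
  assumes "finite P" "f \<in> P" "g \<in> P" "f \<noteq> g"
  shows "min_gap P \<le> \<bar>f - g\<bar>"
proof -
  have "{\<bar>f - g\<bar> | f g. f \<in> P \<and> g \<in> P \<and> f \<noteq> g} \<subseteq> (\<lambda>(f, g). \<bar>f - g\<bar>) ` (P \<times> P)"
    by auto
  then have "finite {\<bar>f - g\<bar> | f g. f \<in> P \<and> g \<in> P \<and> f \<noteq> g}"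
    using assms(1) finite_subset by blast
  then show ?thesis
    unfolding min_gap_def using assms by (intro Min_le) auto
qed

section \<open>Self-similar sets\<close>

context
  fixes E F :: "real set" and q :: real
  assumes self_similar: "E = {f + q * e | f e. f \<in> F \<and> e \<in> E}"
    and q01: "0 < q" "q < 1"
begin

lemma split_first_digit:
  assumes "x \<in> E"
  obtains f e where "x = f + q * e" "f \<in> F" "e \<in> E"
proof -
  have "x \<in> {f + q * e | f e. f \<in> F \<and> e \<in> E}"
    using assms self_similar by (rule subst[where P = "\<lambda>S. x \<in> S", rotated])
  then show ?thesis
    using that by blast
qed

lemma prepend_digit:
  assumes "f \<in> F" "e \<in> E"
  shows "f + q * e \<in> E"
  by (subst self_similar) (use assms in blast)

lemma center_of_digits_subset: "center_of_distances F \<subseteq> center_of_distances E"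
proof
  fix \<alpha> assume \<alpha>: "\<alpha> \<in> center_of_distances F"
  have "\<exists>y\<in>E. dist x y = \<alpha>" if "x \<in> E" for x
  proof -
    obtain f e where x: "x = f + q * e" "f \<in> F" "e \<in> E"
      using \<open>x \<in> E\<close> by (rule split_first_digit)
    obtain g where g: "g \<in> F" "dist f g = \<alpha>"
      using \<alpha> x(2) by (auto simp: center_of_distances_def)
    have "g + q * e \<in> E"
      using prepend_digit g(1) x(3) by blast
    then show ?thesis
      using g(2) x(1) by (intro bexI) (simp_all add: dist_real_def)
  qed
  then show "\<alpha> \<in> center_of_distances E"
    using \<alpha> by (auto simp: center_of_distances_def)
qed

lemma scale_center_of_distances:
  assumes "\<alpha> \<in> center_of_distances E"
  shows "q * \<alpha> \<in> center_of_distances E"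
proof -
  have "\<exists>y\<in>E. dist x y = q * \<alpha>" if "x \<in> E" for x
  proof -
    obtain f e where x: "x = f + q * e" "f \<in> F" "e \<in> E"
      using \<open>x \<in> E\<close> by (rule split_first_digit)
    obtain e' where e': "e' \<in> E" "dist e e' = \<alpha>"
      using assms x(3) by (auto simp: center_of_distances_def)
    have "f + q * e' \<in> E"
      using prepend_digit e'(1) x(2) by blast
    moreover have "dist x (f + q * e') = \<bar>q * (e - e')\<bar>"
      using x(1) by (simp add: dist_real_def algebra_simps)
    ultimately show ?thesis
      using e'(2) q01 by (auto simp: dist_real_def abs_mult)
  qed
  then show ?thesis
    using assms q01 by (auto simp: center_of_distances_def)
qed

lemma scaled_center_of_digits_subset:
  "(\<lambda>x. q ^ k * x) ` center_of_distances F \<subseteq> center_of_distances E"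
proof (induction k)
  case 0
  then show ?case
    using center_of_digits_subset by simp
next
  case (Suc k)
  then show ?case
    using scale_center_of_distances by (auto simp: mult.assoc)
qed

context
  fixes s :: real
  assumes bounds: "E \<subseteq> {0..s}" "0 \<in> E" "s \<in> E"
    and zero_digit: "0 \<in> F"
    and gap: "\<And>f g. f \<in> F \<Longrightarrow> g \<in> F \<Longrightarrow> f \<noteq> g \<Longrightarrow> 2 * q * s < \<bar>f - g\<bar>"
begin

lemma tail_bounds:
  assumes "e \<in> E"
  shows "0 \<le> q * e" "q * e \<le> q * s"
  using assms bounds(1) q01 by auto

lemma digit_eqI:
  assumes "f \<in> F" "g \<in> F" "\<bar>f - g\<bar> \<le> 2 * (q * s)"
  shows "f = g"
  using gap[OF assms(1,2)] assms(3) by force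

text \<open>A tail \<open>e\<close> is tested inside the leftmost piece, at \<open>0 + q * e\<close>: a move by at most \<open>q * s\<close> cannot
  leave that piece, so it is \<open>q\<close> times a move of \<open>e\<close> within \<open>E\<close>.\<close>

lemma small_distance_rescale:
  assumes \<alpha>: "\<alpha> \<in> center_of_distances E" "\<alpha> \<le> q * s"
  shows "\<alpha> / q \<in> center_of_distances E"
proof -
  have "\<exists>e'\<in>E. dist e e' = \<alpha> / q" if e: "e \<in> E" for e
  proof -
    have "0 + q * e \<in> E"
      using prepend_digit zero_digit e by blast
    then obtain y where y: "y \<in> E" "dist (0 + q * e) y = \<alpha>"
      using \<alpha>(1) unfolding center_of_distances_def by blast
    obtain g e' where g: "y = g + q * e'" "g \<in> F" "e' \<in> E"
      using y(1) by (rule split_first_digit)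
    have "\<bar>0 - g\<bar> \<le> 2 * (q * s)"
      using y(2) g(1) \<alpha>(2) tail_bounds[OF e] tail_bounds[OF g(3)]
      by (auto simp: dist_real_def)
    then have "g = 0"
      using digit_eqI[OF zero_digit g(2)] by simp
    then have "\<bar>q * (e - e')\<bar> = \<alpha>"
      using y(2) g(1) by (simp add: dist_real_def right_diff_distrib)
    then have "dist e e' = \<alpha> / q"
      using q01 by (auto simp: dist_real_def abs_mult)
    then show ?thesis
      using g(3) by blast
  qed
  then show ?thesis
    using \<alpha>(1) q01 by (auto simp: center_of_distances_def)
qed

text \<open>Distances exceeding \<open>q * s\<close> are decided by the two extreme points \<open>0\<close> and \<open>q * s\<close> of the
  leftmost piece of \<open>E\<close>, neither of which can be moved to the left.\<close>

lemma large_distance_in_digits: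
  assumes \<alpha>: "\<alpha> \<in> center_of_distances E" "q * s < \<alpha>"
  shows "\<alpha> \<in> F"
proof -
  obtain y where "y \<in> E" "dist 0 y = \<alpha>"
    using \<alpha>(1) bounds(2) unfolding center_of_distances_def by blast
  then have "\<alpha> \<in> E"
    using bounds(1) by (auto simp: dist_real_def)
  then obtain f e where f: "\<alpha> = f + q * e" "f \<in> F" "e \<in> E"
    by (rule split_first_digit)
  have "0 + q * s \<in> E"
    using prepend_digit zero_digit bounds(3) by blast
  then obtain z where z: "z \<in> E" "dist (0 + q * s) z = \<alpha>"
    using \<alpha>(1) unfolding center_of_distances_def by blast
  have "0 \<le> z"
    using z(1) bounds(1) by auto
  then have z_eq: "z = q * s + \<alpha>"
    using z(2) \<alpha>(2) by (auto simp: dist_real_def abs_if split: if_splits)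
  obtain g e' where g: "q * s + \<alpha> = g + q * e'" "g \<in> F" "e' \<in> E"
    using z(1) unfolding z_eq by (rule split_first_digit)
  have "f = g"
    using f(1) g(1) tail_bounds[OF f(3)] tail_bounds[OF g(3)] by (intro digit_eqI f g) auto
  then have "q * e = 0"
    using f(1) g(1) tail_bounds[OF f(3)] tail_bounds[OF g(3)] by linarith
  then show ?thesis
    using f(1,2) by (simp only: add_0_right)
qed

context
  assumes integer_digits: "F \<subseteq> \<int>"
    and short_tail: "q * s < 1"
begin

lemma integer_in_self_similar_set:
  assumes "y \<in> E" "y \<in> \<int>"
  shows "y \<in> F"
proof -
  obtain g e where g: "y = g + q * e" "g \<in> F" "e \<in> E"
    using assms(1) by (rule split_first_digit)
  then have "q * e \<in> \<int>"
    using assms(2) integer_digits by (metis Ints_diff add_diff_cancel_left' subsetD)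
  moreover have "\<bar>q * e\<bar> < 1"
    using tail_bounds[OF g(3)] short_tail by auto
  ultimately have "q * e = 0"
    using Ints_nonzero_abs_less1 by blast
  then have "y = g"
    using g(1) by linarith
  then show ?thesis
    using g(2) by simp
qed

lemma digit_in_self_similar_set:
  assumes "f \<in> F"
  shows "f \<in> E"
proof -
  have "f + q * 0 \<in> E"
    using prepend_digit assms bounds(2) by blast
  then show ?thesis
    by simp
qed

lemma large_distance_in_center_of_digits:
  assumes \<alpha>: "\<alpha> \<in> center_of_distances E" "q * s < \<alpha>"
  shows "\<alpha> \<in> center_of_distances F"
proof -
  have \<alpha>_int: "\<alpha> \<in> \<int>"
    using large_distance_in_digits[OF \<alpha>] integer_digits by blast
  have "\<exists>y\<in>F. dist f y = \<alpha>" if f: "f \<in> F" for f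
  proof -
    obtain y where y: "y \<in> E" "dist f y = \<alpha>"
      using \<alpha>(1) digit_in_self_similar_set[OF f] unfolding center_of_distances_def by blast
    then have "y = f + \<alpha> \<or> y = f - \<alpha>"
      by (auto simp: dist_real_def)
    moreover have "f \<in> \<int>"
      using f integer_digits by blast
    ultimately have "y \<in> \<int>"
      using \<alpha>_int by auto
    then show ?thesis
      using y integer_in_self_similar_set by blast
  qed
  then show ?thesis
    using \<alpha>(1) by (auto simp: center_of_distances_def)
qed

text \<open>The index \<open>k\<close> bounds how many rescalings it takes until \<open>\<alpha>\<close> exceeds \<open>q * s\<close>.\<close>

lemma distance_in_scaled_center_of_digits:
  assumes "\<alpha> \<in> center_of_distances E" "q ^ k * (q * s) < \<alpha>"
  shows "\<exists>j. \<alpha> \<in> (\<lambda>x. q ^ j * x) ` center_of_distances F"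
  using assms
proof (induction k arbitrary: \<alpha>)
  case 0
  then have "\<alpha> \<in> (\<lambda>x. q ^ 0 * x) ` center_of_distances F"
    using large_distance_in_center_of_digits by simp
  then show ?case
    by blast
next
  case (Suc k)
  show ?case
  proof (cases "\<alpha> \<le> q * s")
    case True
    have "\<alpha> / q \<in> center_of_distances E"
      using small_distance_rescale[OF Suc.prems(1) True] .
    moreover have "q ^ k * (q * s) < \<alpha> / q"
      using Suc.prems(2) q01 by (simp add: field_simps)
    ultimately obtain j x where "\<alpha> / q = q ^ j * x" "x \<in> center_of_distances F"
      using Suc.IH by blast
    then have "\<alpha> = q ^ Suc j * x" "x \<in> center_of_distances F"
      using q01 by (simp_all add: field_simps)
    then show ?thesis
      by blast
  next
    case False
    then have "\<alpha> \<in> (\<lambda>x. q ^ 0 * x) ` center_of_distances F"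
      using large_distance_in_center_of_digits Suc.prems(1) by simp
    then show ?thesis
      by blast
  qed
qed

theorem center_of_distances_self_similar:
  "center_of_distances E = (\<Union>k. (\<lambda>x. q ^ k * x) ` center_of_distances F)"
proof (intro equalityI subsetI)
  fix \<alpha> assume \<alpha>: "\<alpha> \<in> center_of_distances E"
  show "\<alpha> \<in> (\<Union>k. (\<lambda>x. q ^ k * x) ` center_of_distances F)"
  proof (cases "\<alpha> = 0")
    case True
    then have "\<alpha> \<in> (\<lambda>x. q ^ 0 * x) ` center_of_distances F"
      using zero_in_center_of_distances by simp
    then show ?thesis
      by blast
  next
    case False
    then have "\<alpha> > 0"
      using \<alpha> by (auto simp: center_of_distances_def)
    moreover have "(\<lambda>k. q ^ k * (q * s)) \<longlonglongrightarrow> 0"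
      using q01 by (intro tendsto_mult_left_zero LIMSEQ_power_zero) auto
    ultimately have "eventually (\<lambda>k. q ^ k * (q * s) < \<alpha>) sequentially"
      by (simp add: order_tendstoD)
    then obtain k where "q ^ k * (q * s) < \<alpha>"
      by (auto simp: eventually_sequentially)
    then show ?thesis
      using distance_in_scaled_center_of_digits[OF \<alpha>] by blast
  qed
next
  fix \<alpha> assume "\<alpha> \<in> (\<Union>k. (\<lambda>x. q ^ k * x) ` center_of_distances F)"
  then show "\<alpha> \<in> center_of_distances E"
    using scaled_center_of_digits_subset by blast
qed

end

end

end

section \<open>Subsums of positive series\<close>

lemma pos_noninc_series_has_sum:
  assumes "pos_noninc_series a"
  shows "(a has_sum series_sum a) {1..}"
proof -
  have nonneg: "\<And>n. a (Suc n) \<ge> 0"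
    using assms by (auto simp: pos_noninc_series_def intro: less_imp_le)
  have "(\<lambda>n. a (Suc n)) sums series_sum a"
    using assms by (auto simp: pos_noninc_series_def series_sum_def summable_sums)
  then have "((\<lambda>n. a (Suc n)) has_sum series_sum a) UNIV"
    using nonneg by (intro sums_nonneg_imp_has_sum) auto
  then have "(a has_sum series_sum a) (Suc ` UNIV)"
    by (subst has_sum_reindex) (auto simp: o_def)
  moreover have "Suc ` UNIV = {1..}"
    by (auto simp: image_iff Suc_le_eq gr0_conv_Suc)
  ultimately show ?thesis
    by simp
qed

lemma subsums_bounds:
  assumes "pos_noninc_series a"
  shows "subsums a \<subseteq> {0..series_sum a}" "0 \<in> subsums a" "series_sum a \<in> subsums a"
proof -
  have total: "(a has_sum series_sum a) {1..}"
    using pos_noninc_series_has_sum[OF assms] .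
  have nonneg: "a n \<ge> 0" if "n \<in> {1..}" for n
    using assms that by (auto simp: pos_noninc_series_def intro: less_imp_le)
  have "0 \<le> infsum a A \<and> infsum a A \<le> series_sum a" if A: "A \<subseteq> {1..}" for A
  proof
    show "0 \<le> infsum a A"
      using A nonneg by (intro infsum_nonneg) blast
    have "a summable_on A"
      using summable_on_subset_banach[OF has_sum_imp_summable[OF total] A] .
    then have "infsum a A \<le> infsum a {1..}"
      using A nonneg total by (intro infsum_mono_neutral) (auto intro: has_sum_imp_summable)
    then show "infsum a A \<le> series_sum a"
      using infsumI[OF total] by simp
  qed
  then show "subsums a \<subseteq> {0..series_sum a}"
    by (auto simp: subsums_def)
  have "infsum a {} = 0"
    by simp
  then show "0 \<in> subsums a"
    unfolding subsums_def by (metis (mono_tags, lifting) empty_subsetI mem_Collect_eq)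
  show "series_sum a \<in> subsums a"
    using infsumI[OF total, symmetric] unfolding subsums_def by blast
qed

lemma finite_initial_subsums: "finite (initial_subsums a k)"
proof -
  have "initial_subsums a k = sum a ` Pow {1..k}"
    by (auto simp: initial_subsums_def)
  then show ?thesis
    by simp
qed

lemma zero_in_initial_subsums: "0 \<in> initial_subsums a k"
  unfolding initial_subsums_def by (intro CollectI exI[of _ "{}"]) simp

text \<open>An index set consists of a part in \<open>{1..m}\<close> and a part beyond \<open>m\<close>; the latter, shifted
  back by \<open>m\<close>, is an arbitrary index set whose terms are multiplied by \<open>q\<close>.\<close>

lemma subsums_self_similar:
  assumes summable: "a summable_on {1..}"
    and shift: "\<And>n. n \<ge> 1 \<Longrightarrow> a (n + m) = q * a n"
  shows "subsums a = {f + q * e | f e. f \<in> initial_subsums a m \<and> e \<in> subsums a}"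
proof -
  have glue: "infsum a (A \<union> (\<lambda>n. n + m) ` B) = sum a A + q * infsum a B"
    if A: "A \<subseteq> {1..m}" and B: "B \<subseteq> {1..}" for A B
  proof -
    have fin: "finite A"
      using A finite_subset by blast
    have "(\<lambda>n. n + m) ` B \<subseteq> {1..}"
      using B by auto
    then have "a summable_on (\<lambda>n. n + m) ` B"
      using summable_on_subset_banach[OF summable] by blast
    moreover have "A \<inter> (\<lambda>n. n + m) ` B = {}"
      using A B by fastforce
    ultimately have "infsum a (A \<union> (\<lambda>n. n + m) ` B) = infsum a A + infsum a ((\<lambda>n. n + m) ` B)"
      using fin by (intro infsum_Un_disjoint) auto
    also have "infsum a A = sum a A"
      using fin by simp
    also have "infsum a ((\<lambda>n. n + m) ` B) = infsum (\<lambda>n. a (n + m)) B"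
      by (subst infsum_reindex) (auto simp: inj_on_def o_def)
    also have "\<dots> = infsum (\<lambda>n. q * a n) B"
      using B shift by (intro infsum_cong) auto
    also have "\<dots> = q * infsum a B"
      by (rule infsum_cmult_right')
    finally show ?thesis .
  qed
  show ?thesis
  proof (intro equalityI subsetI)
    fix x assume "x \<in> subsums a"
    then obtain A where A: "A \<subseteq> {1..}" "x = infsum a A"
      by (auto simp: subsums_def)
    define B where "B = {n. n \<ge> 1 \<and> n + m \<in> A}"
    have "n \<in> (\<lambda>n. n + m) ` B" if "n \<in> A" "n \<notin> {1..m}" for n
      using that A(1) by (intro image_eqI[of _ _ "n - m"]) (auto simp: B_def)
    then have "A = (A \<inter> {1..m}) \<union> (\<lambda>n. n + m) ` B"
      using A(1) by (fastforce simp: B_def)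
    then have "x = sum a (A \<inter> {1..m}) + q * infsum a B"
      using glue[of "A \<inter> {1..m}" B] A(2) by (auto simp: B_def)
    moreover have "sum a (A \<inter> {1..m}) \<in> initial_subsums a m"
      by (auto simp: initial_subsums_def)
    moreover have "infsum a B \<in> subsums a"
      by (auto simp: subsums_def B_def)
    ultimately show "x \<in> {f + q * e | f e. f \<in> initial_subsums a m \<and> e \<in> subsums a}"
      by blast
  next
    fix x assume "x \<in> {f + q * e | f e. f \<in> initial_subsums a m \<and> e \<in> subsums a}"
    then obtain A B where AB: "A \<subseteq> {1..m}" "B \<subseteq> {1..}" "x = sum a A + q * infsum a B"
      by (auto simp: subsums_def initial_subsums_def)
    then have "x = infsum a (A \<union> (\<lambda>n. n + m) ` B)"
      using glue by simp
    moreover have "A \<union> (\<lambda>n. n + m) ` B \<subseteq> {1..}"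
      using AB by auto
    ultimately show "x \<in> subsums a"
      unfolding subsums_def by blast
  qed
qed

section \<open>Multigeometric series\<close>

lemma multigeometric_shift:
  assumes "multigeometric a m l q" "n \<ge> 1"
  shows "a (n + m) = q * a n"
proof -
  define k where "k = (n - 1) div m"
  define i where "i = (n - 1) mod m + 1"
  have "m \<ge> 1"
    using assms(1) by (simp add: multigeometric_def)
  then have i: "i \<in> {1..m}"
    by (simp add: i_def Suc_le_eq)
  have n: "n = k * m + i"
    using assms(2) by (simp add: k_def i_def)
  have terms: "a (k * m + i) = real (l i) * q ^ k" for k
    using assms(1) i by (auto simp: multigeometric_def)
  have "n + m = Suc k * m + i"
    using n by simp
  then have "a (n + m) = real (l i) * q ^ Suc k"
    by (simp only: terms)
  then show ?thesis
    using terms[of k] n by simp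
qed

lemma multigeometric_initial_subsums_Ints:
  assumes "multigeometric a m l q"
  shows "initial_subsums a m \<subseteq> \<int>"
proof -
  have "a i \<in> \<int>" if "i \<in> {1..m}" for i
  proof -
    have "\<forall>k. \<forall>i\<in>{1..m}. a (k * m + i) = real (l i) * q ^ k"
      using assms by (simp add: multigeometric_def)
    then have "a (0 * m + i) = real (l i) * q ^ 0"
      using that by blast
    then show ?thesis
      by simp
  qed
  then show ?thesis
    by (auto simp: initial_subsums_def intro!: Ints_sum)
qed

theorem theorem4p1:
  fixes a :: "nat \<Rightarrow> real" and m :: nat and l :: "nat \<Rightarrow> nat" and q s :: real
  assumes "multigeometric a m l q"
    and "s = series_sum a"
    and "2 * q * s < min_gap (initial_subsums a m)"
    and "q * s < 1"
  shows "center_of_distances (subsums a) =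
           (\<Union>k::nat. (\<lambda>x. q ^ k * x) ` center_of_distances (initial_subsums a m))"
proof -
  have series: "pos_noninc_series a" and q: "0 < q" "q < 1"
    using assms(1) by (auto simp: multigeometric_def)
  show ?thesis
  proof (rule center_of_distances_self_similar)
    show "subsums a = {f + q * e | f e. f \<in> initial_subsums a m \<and> e \<in> subsums a}"
      using has_sum_imp_summable[OF pos_noninc_series_has_sum[OF series]]
        multigeometric_shift[OF assms(1)] by (rule subsums_self_similar)
    show "subsums a \<subseteq> {0..s}" "0 \<in> subsums a" "s \<in> subsums a"
      using subsums_bounds[OF series] assms(2) by simp_all
    show "2 * q * s < \<bar>f - g\<bar>"
      if "f \<in> initial_subsums a m" "g \<in> initial_subsums a m" "f \<noteq> g" for f g
      using assms(3) min_gap_le[OF finite_initial_subsums that] by linarith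
  qed (use q assms(4) zero_in_initial_subsums multigeometric_initial_subsums_Ints[OF assms(1)]
      in auto)
qed

end
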